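(* Let $X\subseteq\mathbb{R}^n$ be a closed convex set and let $f=(f_1,\dots,f_m):\mathbb{R}\times X\to\mathbb{R}^m$ be such that, for every $T>0$, $t\mapsto f(t,x)$ is integrable on $[0,T]$ for each $x\in X$, and each $x\mapsto f_i(t,x)$ is convex on $X$ for each $t$. Suppose the environment $f$ is viable: there exists $x^\dagger\in X$ with $f(t,x^\dagger)\le 0$ (componentwise) for all $t\ge0$. Let $\varepsilon>0$, $x(0)\in X$, $\lambda(0)\in\Lambda=\mathbb{R}^m_+$, and let $(x(t),\lambda(t))\in X\times\Lambda$, $t\ge0$, be a solution of the saddle point controller $$\dot x=\Pi_X\big(x,-\varepsilon f_x(t,x)\lambda\big),\qquad \dot\lambda=\Pi_\Lambda\big(\lambda,\varepsilon f(t,x)\big).$$ Then $x(t)$ is strongly feasible, i.e. there is a constant vector $C$, independent of $T$, such that the fit $\mathcal{F}_T=\int_0^T f(t,x(t))\,dt$ satisfies $\mathcal{F}_T\le C$ for all $T>0$. Specifically, for all $T>0$ and all $i=1,\dots,m$, $$\mathcal{F}_{T,i}=\int_0^T f_i(t,x(t))\,dt\ \le\ \min_{x^\dagger\in X^\dagger}\frac1\varepsilon V_{x^\dagger,e_i}(x(0),\lambda(0)),$$ where $X^\dagger=\{x^\dagger\in X: f(t,x^\dagger)\le0 \text{ for all } t\in[0,T]\}$, $e_1,\dots,e_m$ is the canonical basis of $\mathbb{R}^m$, and $V_{\bar x,\bar\lambda}(x,\lambda)=\frac12\big(\|x-\bar x\|^2+\|\lambda-\bar\lambda\|^2\big)$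.
   Context: Projection: for a closed convex set $Y\subseteq\mathbb{R}^k$, $P_Y(z)=\operatorname{argmin}_{y\in Y}\|y-z\|$ (Euclidean norm), and for $y\in Y$, $v\in\mathbb{R}^k$, $\Pi_Y(y,v)=\lim_{\delta\to0^+}\big(P_Y(y+\delta v)-y\big)/\delta$. Subgradients: for a convex $g:X\to\mathbb{R}$, a subgradient $g_x(x)$ at $x\in X$ is a vector with $g(y)\ge g(x)+g_x(x)^T(y-x)$ for all $y\in X$. Subgradients of $f_i(t,\cdot)$ are assumed to exist at all points of $X$, and $f_x(t,x)=[f_{1,x}(t,x)\ \cdots\ f_{m,x}(t,x)]\in\mathbb{R}^{n\times m}$ is the matrix whose columns are (fixed choices of) subgradients of $f_i(t,\cdot)$ at $x$. Inequalities between vectors are componentwise. A solution of the differential equations is a pair of functions absolutely continuous on bounded time intervals satisfying the equations for almost every $t$. The integrals defining the fit along the trajectory are assumed to be well defined. *)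

theory Defs
  imports "HOL-Analysis.Analysis"
begin

text \<open>
  Projected direction at a point of a closed convex set. For a point \<open>y\<close> of a nonempty closed
  convex set \<open>Y\<close> the limit exists, so \<open>Lim\<close> denotes an actual limit.
\<close>

definition proj_dir :: "'a::euclidean_space set \<Rightarrow> 'a \<Rightarrow> 'a \<Rightarrow> 'a" where
  "proj_dir Y y v =
     Lim (at_right 0) (\<lambda>\<delta>::real. (closest_point Y (y + \<delta> *\<^sub>R v) - y) /\<^sub>R \<delta>)"

definition is_subgradient ::
    "'a::euclidean_space set \<Rightarrow> ('a \<Rightarrow> real) \<Rightarrow> 'a \<Rightarrow> 'a \<Rightarrow> bool" where
  "is_subgradient X g x v \<longleftrightarrow> (\<forall>y\<in>X. g y \<ge> g x + v \<bullet> (y - x))"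

text \<open>
  Absolute continuity in the usual \<open>\<epsilon>\<close>-\<open>\<delta>\<close> sense: \<open>D\<close> ranges over the finite families of
  non-overlapping compact intervals contained in \<open>S\<close>.
\<close>

definition abs_continuous_on :: "real set \<Rightarrow> (real \<Rightarrow> 'a::real_normed_vector) \<Rightarrow> bool" where
  "abs_continuous_on S g \<longleftrightarrow>
     (\<forall>e>0. \<exists>d>0. \<forall>D. D division_of (\<Union>D) \<and> \<Union>D \<subseteq> S \<and> (\<Sum>K\<in>D. measure lborel K) < d \<longrightarrow>
        (\<Sum>K\<in>D. norm (g (Sup K) - g (Inf K))) < e)"

text \<open>
  Environments \<open>f\<close> are total functions here, but only their values at points of \<open>X\<close> are used.
  The order on \<open>real ^ 'm\<close> is the componentwise one, so \<open>{0..}\<close> is the nonnegative orthant.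
\<close>

definition viable :: "'a set \<Rightarrow> (real \<Rightarrow> 'a \<Rightarrow> real ^ 'm) \<Rightarrow> bool" where
  "viable X f \<longleftrightarrow> (\<exists>x\<in>X. \<forall>t\<ge>0. f t x \<le> 0)"

definition feasible_points :: "'a set \<Rightarrow> (real \<Rightarrow> 'a \<Rightarrow> real ^ 'm) \<Rightarrow> real \<Rightarrow> 'a set" where
  "feasible_points X f T = {x \<in> X. \<forall>t\<in>{0..T}. f t x \<le> 0}"

definition fit :: "(real \<Rightarrow> 'a \<Rightarrow> real ^ 'm) \<Rightarrow> (real \<Rightarrow> 'a) \<Rightarrow> real \<Rightarrow> real ^ 'm" where
  "fit f x T = (LINT t:{0..T}|lebesgue. f t (x t))"

definition strongly_feasible :: "(real \<Rightarrow> 'a \<Rightarrow> real ^ 'm) \<Rightarrow> (real \<Rightarrow> 'a) \<Rightarrow> bool" where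
  "strongly_feasible f x \<longleftrightarrow> (\<exists>C. \<forall>T>0. fit f x T \<le> C)"

definition energy :: "real ^ 'n \<Rightarrow> real ^ 'm \<Rightarrow> real ^ 'n \<Rightarrow> real ^ 'm \<Rightarrow> real" where
  "energy xbar lbar x l = 1/2 * ((norm (x - xbar))\<^sup>2 + (norm (l - lbar))\<^sup>2)"

text \<open>
  \<open>fx t x\<close> is an \<open>n \<times> m\<close> matrix (rows indexed by \<open>'n\<close>, columns by \<open>'m\<close>).
  Trajectories only matter for \<open>t \<ge> 0\<close>.
\<close>

definition saddle_point_solution ::
    "(real ^ 'n) set \<Rightarrow> (real \<Rightarrow> real ^ 'n \<Rightarrow> real ^ 'm) \<Rightarrow> (real \<Rightarrow> real ^ 'n \<Rightarrow> real ^ 'm ^ 'n) \<Rightarrow>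
     real \<Rightarrow> (real \<Rightarrow> real ^ 'n) \<Rightarrow> (real \<Rightarrow> real ^ 'm) \<Rightarrow> bool" where
  "saddle_point_solution X f fx \<epsilon> x l \<longleftrightarrow>
     (\<forall>t\<ge>0. x t \<in> X \<and> l t \<in> {0..}) \<and>
     (\<forall>T>0. abs_continuous_on {0..T} x \<and> abs_continuous_on {0..T} l) \<and>
     (AE t in lebesgue. t \<ge> 0 \<longrightarrow>
        (x has_vector_derivative proj_dir X (x t) (- (\<epsilon> *\<^sub>R (fx t (x t) *v l t))))
          (at t within {0..}) \<and>
        (l has_vector_derivative proj_dir {0..} (l t) (\<epsilon> *\<^sub>R f t (x t)))
          (at t within {0..}))"

end

theory Submission
  imports Defs
begin

text \<open>
  Along a solution the energy \<open>V\<close> centred at a feasible \<open>z\<close> and at \<open>e\<^sub>i\<close> is absolutely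
  continuous. Since \<open>(y - z) \<bullet> \<Pi>\<^sub>Y(y, v) \<le> (y - z) \<bullet> v\<close> for \<open>z \<in> Y\<close>, both projections can be dropped
  from its derivative; the subgradient inequality and \<open>\<lambda> \<ge> 0\<close>, \<open>f(t, z) \<le> 0\<close> then give
  \<open>V' \<le> - \<epsilon> f\<^sub>i(t, x(t))\<close> almost everywhere. Integrating and using \<open>V \<ge> 0\<close> bounds the fit by
  \<open>V(0) / \<epsilon>\<close>. The minimum over the feasible points is attained because convex functions with
  subgradients everywhere on \<open>X\<close> are lower semicontinuous there.
\<close>

section \<open>Projected directions on a closed convex set\<close>

text \<open>
  The difference quotients are the projections of \<open>v\<close> onto the increasing sets \<open>(Y - y) / \<delta>\<close>;
  they converge to the projection of \<open>v\<close> onto the tangent cone, the closure of their union.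
\<close>

lemma convergent_projection_quotient:
  fixes Y :: "'a::euclidean_space set"
  assumes Y: "closed Y" "convex Y" "y \<in> Y"
  shows "\<exists>p. ((\<lambda>\<delta>::real. (closest_point Y (y + \<delta> *\<^sub>R v) - y) /\<^sub>R \<delta>) \<longlongrightarrow> p) (at_right 0)"
proof -
  define S where "S = cone hull ((\<lambda>u. u - y) ` Y)"
  define p where "p = closest_point (closure S) v"
  define w where "w = (\<lambda>\<delta>::real. (closest_point Y (y + \<delta> *\<^sub>R v) - y) /\<^sub>R \<delta>)"
  have "convex ((\<lambda>u. u - y) ` Y)"
    using convex_translation_subtract[OF Y(2)] by simp
  then have cS: "convex (closure S)"
    unfolding S_def by (intro convex_closure convex_cone_hull)
  have "S \<noteq> {}" unfolding S_def using Y(3) by (auto simp flip: cone_hull_empty_iff)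
  have S_I: "c *\<^sub>R (u - y) \<in> S" if "c \<ge> 0" "u \<in> Y" for c u
    unfolding S_def cone_hull_expl using that by blast
  have S_E: "\<exists>c u. c \<ge> 0 \<and> u \<in> Y \<and> k = c *\<^sub>R (u - y)" if "k \<in> S" for k
    using that unfolding S_def cone_hull_expl by blast
  have pS: "p \<in> closure S"
    unfolding p_def by (rule closest_point_in_set) (use \<open>S \<noteq> {}\<close> in auto)
  have wS: "w \<delta> \<in> closure S" if "\<delta> > 0" for \<delta>
  proof -
    have "closest_point Y (y + \<delta> *\<^sub>R v) \<in> Y"
      by (rule closest_point_in_set) (use Y in auto)
    then have "w \<delta> \<in> S"
      unfolding w_def by (intro S_I) (use that in auto)
    then show ?thesis using closure_subset by blast
  qed
  \<comment> \<open>Since \<open>w \<delta>\<close> lies in \<open>closure S\<close>, the angle at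
    the projection \<open>p\<close> between \<open>v\<close> and \<open>w \<delta>\<close> is not
    acute. Expanding the square then shows that \<open>w \<delta>\<close> is near \<open>p\<close>
    as soon as it is nearly as close to \<open>v\<close> as \<open>p\<close> is.\<close>
  have est: "(norm (w \<delta> - p))\<^sup>2 \<le> (norm (v - w \<delta>))\<^sup>2 - (norm (v - p))\<^sup>2" if "\<delta> > 0" for \<delta>
  proof -
    have "(v - p) \<bullet> (w \<delta> - p) \<le> 0"
      unfolding p_def by (rule closest_point_dot[OF cS closed_closure wS[OF that]])
    moreover have "(norm (v - w \<delta>))\<^sup>2 = (norm (v - p))\<^sup>2 + (norm (w \<delta> - p))\<^sup>2 - 2 * ((v - p) \<bullet> (w \<delta> - p))"
      unfolding power2_norm_eq_inner by (simp add: inner_diff inner_commute algebra_simps)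
    ultimately show ?thesis by linarith
  qed
  \<comment> \<open>Once \<delta> is small compared with the scaling factor of \<open>k\<close>, the
    point \<open>y + \<delta> *\<^sub>R k\<close> lies in \<open>Y\<close> and competes with the
    closest point; dividing by \<delta> compares \<open>w \<delta>\<close> with
    \<open>k\<close>.\<close>
  have opt: "\<forall>\<^sub>F \<delta> in at_right 0. norm (v - w \<delta>) \<le> norm (v - k)" if "k \<in> S" for k
  proof -
    obtain c u where k: "c \<ge> 0" "u \<in> Y" "k = c *\<^sub>R (u - y)" using S_E \<open>k \<in> S\<close> by metis
    \<comment> \<open>Using \<open>c + 1\<close> instead of \<open>c\<close> covers
      \<open>c = 0\<close>.\<close>
    have "\<forall>\<^sub>F \<delta> in at_right (0::real). \<delta> < 1 / (c + 1)"
      by (rule order_tendstoD(2)[OF tendsto_ident_at]) (use k in auto)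
    moreover have "\<forall>\<^sub>F \<delta> in at_right (0::real). \<delta> > 0"
      by (rule eventually_at_right_less)
    ultimately show ?thesis
    proof eventually_elim
      case (elim \<delta>)
      then have "\<delta> * c + \<delta> < 1" using k by (simp add: field_simps)
      then have dc: "\<delta> * c \<le> 1" "0 \<le> \<delta> * c" using elim k by auto
      have "(1 - \<delta> * c) *\<^sub>R y + (\<delta> * c) *\<^sub>R u \<in> Y"
        by (rule convexD) (use Y k dc in auto)
      also have "(1 - \<delta> * c) *\<^sub>R y + (\<delta> * c) *\<^sub>R u = y + \<delta> *\<^sub>R k"
        by (simp add: k algebra_simps)
      finally have "dist (y + \<delta> *\<^sub>R v) (closest_point Y (y + \<delta> *\<^sub>R v)) \<le> dist (y + \<delta> *\<^sub>R v) (y + \<delta> *\<^sub>R k)"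
        by (rule closest_point_le[OF Y(1)])
      moreover have "closest_point Y (y + \<delta> *\<^sub>R v) = y + \<delta> *\<^sub>R w \<delta>"
        using elim by (simp add: w_def)
      ultimately have "norm (\<delta> *\<^sub>R (v - w \<delta>)) \<le> norm (\<delta> *\<^sub>R (v - k))"
        by (simp add: dist_norm algebra_simps)
      then show ?case using elim by simp
    qed
  qed
  have "(w \<longlongrightarrow> p) (at_right 0)"
  proof (rule tendstoI)
    fix e :: real assume "e > 0"
    \<comment> \<open>The limit \<open>p\<close> may lie outside \<open>S\<close>, where
      \<open>opt\<close> does not apply, so it is replaced by a point \<open>K n\<close> of
      \<open>S\<close> whose squared distance to \<open>v\<close> exceeds the optimal one by less
      than \<open>e\<^sup>2\<close>.\<close>
    obtain K where K: "\<And>n. K n \<in> S" "K \<longlonglongrightarrow> p"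
      using pS unfolding closure_sequential by blast
    have "(\<lambda>n. (norm (v - K n))\<^sup>2) \<longlonglongrightarrow> (norm (v - p))\<^sup>2"
      by (intro tendsto_intros K)
    then have "\<forall>\<^sub>F n in sequentially. (norm (v - K n))\<^sup>2 < (norm (v - p))\<^sup>2 + e\<^sup>2"
      by (rule order_tendstoD(2)) (use \<open>e > 0\<close> in auto)
    then obtain n where n: "(norm (v - K n))\<^sup>2 < (norm (v - p))\<^sup>2 + e\<^sup>2"
      using eventually_happens by force
    show "\<forall>\<^sub>F \<delta> in at_right 0. dist (w \<delta>) p < e"
      using opt[OF K(1)[of n]] eventually_at_right_less
    proof eventually_elim
      case (elim \<delta>)
      have "(norm (v - w \<delta>))\<^sup>2 \<le> (norm (v - K n))\<^sup>2"
        using elim by (intro power_mono) auto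
      then have "(norm (w \<delta> - p))\<^sup>2 < e\<^sup>2"
        using est[of \<delta>] elim n by linarith
      then show ?case
        using \<open>e > 0\<close> by (simp add: dist_norm power2_less_imp_less)
    qed
  qed
  then show ?thesis unfolding w_def by blast
qed

text \<open>The residual \<open>v - proj_dir Y y v\<close> is an outward normal to \<open>Y\<close>
  at \<open>y\<close>: it is a limit of rescaled residuals of closest points, each of which
  satisfies the variational inequality tested at \<open>z\<close>.\<close>

lemma inner_proj_dir_le:
  fixes Y :: "'a::euclidean_space set"
  assumes Y: "closed Y" "convex Y" "y \<in> Y" and z: "z \<in> Y"
  shows "(y - z) \<bullet> proj_dir Y y v \<le> (y - z) \<bullet> v"
proof -
  define w where "w = (\<lambda>\<delta>::real. (closest_point Y (y + \<delta> *\<^sub>R v) - y) /\<^sub>R \<delta>)"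
  obtain p where p: "(w \<longlongrightarrow> p) (at_right 0)"
    using convergent_projection_quotient[OF Y] unfolding w_def by blast
  have pd: "proj_dir Y y v = p"
    unfolding proj_dir_def w_def[symmetric] by (rule tendsto_Lim[OF _ p]) simp
  \<comment> \<open>In the limit the closest point \<open>y + \<delta> *\<^sub>R w \<delta>\<close>
    returns to \<open>y\<close>, so only \<open>z - y\<close> is left in the second factor.\<close>
  have "((\<lambda>\<delta>. (v - w \<delta>) \<bullet> (z - y - \<delta> *\<^sub>R w \<delta>)) \<longlongrightarrow> (v - p) \<bullet> (z - y - 0 *\<^sub>R p)) (at_right 0)"
    by (intro tendsto_intros p)
  moreover have "\<forall>\<^sub>F \<delta> in at_right 0. (v - w \<delta>) \<bullet> (z - y - \<delta> *\<^sub>R w \<delta>) \<le> 0"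
    using eventually_at_right_less
  proof eventually_elim
    case (elim \<delta>)
    have "closest_point Y (y + \<delta> *\<^sub>R v) = y + \<delta> *\<^sub>R w \<delta>"
      using elim by (simp add: w_def)
    then have "(y + \<delta> *\<^sub>R v - (y + \<delta> *\<^sub>R w \<delta>)) \<bullet> (z - (y + \<delta> *\<^sub>R w \<delta>)) \<le> 0"
      using closest_point_dot[OF Y(2,1) z, of "y + \<delta> *\<^sub>R v"] by simp
    also have "y + \<delta> *\<^sub>R v - (y + \<delta> *\<^sub>R w \<delta>) = \<delta> *\<^sub>R (v - w \<delta>)"
      by (simp add: algebra_simps)
    finally have "\<delta> * ((v - w \<delta>) \<bullet> (z - y - \<delta> *\<^sub>R w \<delta>)) \<le> 0"
      by (simp add: diff_diff_eq)
    then show ?case using elim by (simp add: mult_le_0_iff)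
  qed
  ultimately have "(v - p) \<bullet> (z - y - 0 *\<^sub>R p) \<le> 0"
    by (rule tendsto_upperbound) simp
  then show ?thesis by (simp add: pd inner_diff algebra_simps inner_commute)
qed

section \<open>Absolutely continuous functions and the energy along a trajectory\<close>

lemma abs_continuous_on_imp_continuous_on:
  fixes g :: "real \<Rightarrow> 'a::real_normed_vector"
  assumes "abs_continuous_on {a..b} g"
  shows "continuous_on {a..b} g"
  unfolding continuous_on_iff
proof (intro ballI allI impI)
  fix s e :: real assume s: "s \<in> {a..b}" and "e > 0"
  then obtain d where "d > 0" and d: "\<And>D. D division_of (\<Union>D) \<Longrightarrow> \<Union>D \<subseteq> {a..b} \<Longrightarrow>
      (\<Sum>K\<in>D. measure lborel K) < d \<Longrightarrow> (\<Sum>K\<in>D. norm (g (Sup K) - g (Inf K))) < e"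
    using assms unfolding abs_continuous_on_def by meson
  \<comment> \<open>A division consisting of a single interval suffices for continuity.\<close>
  have *: "norm (g v - g u) < e" if "u \<le> v" "v - u < d" "u \<in> {a..b}" "v \<in> {a..b}" for u v
    using d[of "{{u..v}}"] that division_of_self[of u v] by (auto simp: box_real)
  show "\<exists>d>0. \<forall>s'\<in>{a..b}. dist s' s < d \<longrightarrow> dist (g s') (g s) < e"
  proof (intro exI[of _ d] conjI ballI impI \<open>d > 0\<close>)
    fix s' assume "s' \<in> {a..b}" "dist s' s < d"
    then show "dist (g s') (g s) < e"
      using *[of s s'] *[of s' s] s
      by (cases "s \<le> s'") (auto simp: dist_norm norm_minus_commute)
  qed
qed

text \<open>Serves to pass absolute continuity from the pair of trajectories to the energy: over any
  one division the increments of \<open>g\<close> and of \<open>h\<close> are summed separately,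
  each kept below half of \<open>e / M\<close>.\<close>

lemma abs_continuous_on_bound:
  fixes g :: "real \<Rightarrow> 'a::real_normed_vector" and h :: "real \<Rightarrow> 'b::real_normed_vector"
    and k :: "real \<Rightarrow> 'c::real_normed_vector"
  assumes g: "abs_continuous_on {a..b} g" and h: "abs_continuous_on {a..b} h"
    and bound: "\<And>u v. u \<in> {a..b} \<Longrightarrow> v \<in> {a..b} \<Longrightarrow>
      norm (k v - k u) \<le> M * (norm (g v - g u) + norm (h v - h u))"
    and "M > 0"
  shows "abs_continuous_on {a..b} k"
  unfolding abs_continuous_on_def
proof (intro allI impI)
  fix e :: real assume "e > 0"
  with \<open>M > 0\<close> have e': "e / (2 * M) > 0" by simp
  obtain d1 where "d1 > 0" and d1: "\<And>D. D division_of (\<Union>D) \<Longrightarrow> \<Union>D \<subseteq> {a..b} \<Longrightarrow>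
      (\<Sum>K\<in>D. measure lborel K) < d1 \<Longrightarrow> (\<Sum>K\<in>D. norm (g (Sup K) - g (Inf K))) < e / (2 * M)"
    using g e' unfolding abs_continuous_on_def by meson
  obtain d2 where "d2 > 0" and d2: "\<And>D. D division_of (\<Union>D) \<Longrightarrow> \<Union>D \<subseteq> {a..b} \<Longrightarrow>
      (\<Sum>K\<in>D. measure lborel K) < d2 \<Longrightarrow> (\<Sum>K\<in>D. norm (h (Sup K) - h (Inf K))) < e / (2 * M)"
    using h e' unfolding abs_continuous_on_def by meson
  show "\<exists>d>0. \<forall>D. D division_of (\<Union>D) \<and> \<Union>D \<subseteq> {a..b} \<and> (\<Sum>K\<in>D. measure lborel K) < d \<longrightarrow>
        (\<Sum>K\<in>D. norm (k (Sup K) - k (Inf K))) < e"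
  proof (intro exI[of _ "min d1 d2"] conjI allI impI)
    show "min d1 d2 > 0" using \<open>d1 > 0\<close> \<open>d2 > 0\<close> by simp
    fix D assume D: "D division_of (\<Union>D) \<and> \<Union>D \<subseteq> {a..b} \<and> (\<Sum>K\<in>D. measure lborel K) < min d1 d2"
    have "(\<Sum>K\<in>D. norm (k (Sup K) - k (Inf K))) \<le>
        (\<Sum>K\<in>D. M * (norm (g (Sup K) - g (Inf K)) + norm (h (Sup K) - h (Inf K))))"
    proof (rule sum_mono, rule bound)
      fix K assume "K \<in> D"
      with D obtain u v where "K = cbox u v" "K \<noteq> {}" "K \<subseteq> {a..b}"
        by (metis division_ofD(3,4) Union_upper subset_trans)
      then show "Inf K \<in> {a..b}" "Sup K \<in> {a..b}" by auto
    qed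
    also have "\<dots> = M * ((\<Sum>K\<in>D. norm (g (Sup K) - g (Inf K))) + (\<Sum>K\<in>D. norm (h (Sup K) - h (Inf K))))"
      by (simp add: sum_distrib_left sum.distrib distrib_left)
    also have "\<dots> < M * (e / (2 * M) + e / (2 * M))"
      using d1[of D] d2[of D] D \<open>M > 0\<close> by (intro mult_strict_left_mono add_strict_mono) auto
    also have "\<dots> = e" using \<open>M > 0\<close> by simp
    finally show "(\<Sum>K\<in>D. norm (k (Sup K) - k (Inf K))) < e" .
  qed
qed

lemma abs_norm_power2_diff_le:
  fixes u v :: "'a::real_normed_vector"
  assumes "norm u \<le> B" "norm v \<le> B"
  shows "\<bar>(norm v)\<^sup>2 - (norm u)\<^sup>2\<bar> \<le> 2 * B * norm (v - u)"
proof -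
  have "\<bar>(norm v)\<^sup>2 - (norm u)\<^sup>2\<bar> = \<bar>norm v - norm u\<bar> * \<bar>norm v + norm u\<bar>"
    unfolding abs_mult[symmetric] by (simp add: power2_eq_square algebra_simps)
  also have "\<dots> \<le> norm (v - u) * (2 * B)"
    using assms by (intro mult_mono norm_triangle_ineq3) auto
  finally show ?thesis by (simp add: mult_ac)
qed

text \<open>Continuous trajectories are bounded on a compact interval, and the squared norm is
  Lipschitz on bounded sets.\<close>

lemma abs_continuous_on_energy:
  fixes x :: "real \<Rightarrow> real ^ 'n" and l :: "real \<Rightarrow> real ^ 'm"
  assumes x: "abs_continuous_on {a..b} x" and l: "abs_continuous_on {a..b} l"
  shows "abs_continuous_on {a..b} (\<lambda>t. energy z y (x t) (l t))"
proof -
  have "compact ((\<lambda>t. x t - z) ` {a..b})" "compact ((\<lambda>t. l t - y) ` {a..b})"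
    by (intro compact_continuous_image continuous_on_diff continuous_on_const compact_Icc
      x[THEN abs_continuous_on_imp_continuous_on] l[THEN abs_continuous_on_imp_continuous_on])+
  then have "bounded ((\<lambda>t. x t - z) ` {a..b})" "bounded ((\<lambda>t. l t - y) ` {a..b})"
    by (auto intro: compact_imp_bounded)
  then obtain B1 B2 where B1: "\<forall>t\<in>{a..b}. norm (x t - z) \<le> B1"
    and B2: "\<forall>t\<in>{a..b}. norm (l t - y) \<le> B2"
    unfolding bounded_iff by auto
  \<comment> \<open>The \<open>1\<close> keeps \<open>M\<close> positive even when the bounds vanish
    or the interval is empty.\<close>
  define M where "M = max 1 (max B1 B2)"
  show ?thesis
  proof (rule abs_continuous_on_bound[OF x l])
    show "M > 0" by (simp add: M_def)
    fix u v assume uv: "u \<in> {a..b}" "v \<in> {a..b}"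
    have "\<bar>(norm (x v - z))\<^sup>2 - (norm (x u - z))\<^sup>2\<bar> \<le> 2 * M * norm (x v - z - (x u - z))"
      using B1 uv by (intro abs_norm_power2_diff_le) (force simp: M_def)+
    moreover have "\<bar>(norm (l v - y))\<^sup>2 - (norm (l u - y))\<^sup>2\<bar> \<le> 2 * M * norm (l v - y - (l u - y))"
      using B2 uv by (intro abs_norm_power2_diff_le) (force simp: M_def)+
    ultimately show "norm (energy z y (x v) (l v) - energy z y (x u) (l u)) \<le>
        M * (norm (x v - x u) + norm (l v - l u))"
      by (simp add: energy_def algebra_simps)
  qed
qed

lemma energy_has_real_derivative:
  fixes x :: "real \<Rightarrow> real ^ 'n" and l :: "real \<Rightarrow> real ^ 'm"
  assumes "(x has_vector_derivative x') (at t within S)" "(l has_vector_derivative l') (at t within S)"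
  shows "((\<lambda>t. energy z y (x t) (l t)) has_real_derivative ((x t - z) \<bullet> x' + (l t - y) \<bullet> l')) (at t within S)"
  using assms unfolding energy_def power2_norm_eq_inner has_vector_derivative_def has_field_derivative_def
  by (auto intro!: derivative_eq_intros simp: fun_eq_iff inner_commute algebra_simps)

section \<open>Integrating an almost everywhere bound on the derivative\<close>

text \<open>
  On a fine tagged division of \<open>[a, b]\<close> the increments at tags outside the null set are controlled
  by the derivative; those at tags inside it are small by absolute continuity, since the gauge
  keeps their intervals within an open set of small measure.
\<close>

lemma abs_continuous_on_increment_le_integral:
  fixes \<phi> h :: "real \<Rightarrow> real"
  assumes ac: "abs_continuous_on {a..b} \<phi>" and "a \<le> b"
    and N: "negligible N"
    and der: "\<And>t. t \<in> {a..b} - N \<Longrightarrow> \<exists>D. (\<phi> has_real_derivative D) (at t within {a..b}) \<and> D \<le> h t"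
    and h: "(h has_integral I) {a..b}"
  shows "\<phi> b - \<phi> a \<le> I"
proof (rule field_le_epsilon)
  fix e0 :: real assume "e0 > 0"
  \<comment> \<open>The error budget: \<open>e\<close> for the tags in \<open>N\<close>,
    \<open>e\<close> for the Riemann sum, and \<open>e * (b - a)\<close> for the differentiability
    errors at the other tags.\<close>
  define e where "e = e0 / (b - a + 2)"
  have "e > 0" using \<open>e0 > 0\<close> \<open>a \<le> b\<close> by (simp add: e_def)
  obtain d where "d > 0" and d: "\<And>D. D division_of (\<Union>D) \<Longrightarrow> \<Union>D \<subseteq> {a..b} \<Longrightarrow>
      (\<Sum>K\<in>D. measure lborel K) < d \<Longrightarrow> (\<Sum>K\<in>D. norm (\<phi> (Sup K) - \<phi> (Inf K))) < e"
    using ac \<open>e > 0\<close> unfolding abs_continuous_on_def by meson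
  have N': "N \<in> null_sets lebesgue" using N by (simp add: negligible_iff_null_sets)
  then obtain U where U: "open U" "N \<subseteq> U" "U - N \<in> lmeasurable"
    "emeasure lebesgue (U - N) < ennreal d"
    using sets_lebesgue_outer_open[of N d] \<open>d > 0\<close> by blast
  have "U = (U - N) \<union> N" using U(2) by blast
  then have Um: "U \<in> lmeasurable"
    using fmeasurable.Un[OF U(3)] negligible_imp_measurable[OF N] by metis
  have "measure lebesgue U = measure lebesgue (U - N)"
    using Um N' by (simp add: measure_Diff_null_set)
  then have Ud: "measure lebesgue U < d"
    using U(3,4) by (simp add: emeasure_eq_measure2 ennreal_less_iff)
  \<comment> \<open>Nothing is known about \<open>h\<close> on \<open>N\<close>; setting it to zero
    there keeps the integral and removes the tags in \<open>N\<close> from the Riemann sum.\<close>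
  define h' where "h' = (\<lambda>t. if t \<in> N then 0 else h t)"
  have "(h' has_integral I) (cbox a b)"
    by (rule has_integral_spike[OF N _ h[folded box_real(2)]]) (simp add: h'_def)
  then obtain \<gamma>1 where \<gamma>1: "gauge \<gamma>1" "\<And>p. p tagged_division_of (cbox a b) \<Longrightarrow> \<gamma>1 fine p \<Longrightarrow>
      norm ((\<Sum>(t,K)\<in>p. measure lborel K *\<^sub>R h' t) - I) < e"
    using \<open>e > 0\<close> unfolding has_integral by meson
  \<comment> \<open>The radius of the gauge: at tags in \<open>N\<close> it confines intervals to
    \<open>U\<close>, at the other tags of \<open>{a..b}\<close> it gives the straddle estimate for
    intervals around \<open>t\<close>.\<close>
  have "\<exists>r>0. (t \<in> N \<longrightarrow> ball t r \<subseteq> U) \<and> (t \<in> {a..b} - N \<longrightarrow>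
      (\<forall>u v. u \<in> {a..b} \<longrightarrow> v \<in> {a..b} \<longrightarrow> u \<in> ball t r \<longrightarrow> v \<in> ball t r \<longrightarrow> u \<le> t \<longrightarrow> t \<le> v \<longrightarrow>
        \<phi> v - \<phi> u \<le> (h t + e) * (v - u)))" for t
  proof (cases "t \<in> N")
    case True
    with U show ?thesis by (meson DiffD2 openE subsetD)
  next
    case False
    show ?thesis
    proof (cases "t \<in> {a..b}")
      case True
      then obtain D where D: "(\<phi> has_real_derivative D) (at t within {a..b})" "D \<le> h t"
        using der False by auto
      then obtain r where "r > 0" and r: "\<And>s. s \<in> {a..b} \<Longrightarrow> norm (s - t) < r \<Longrightarrow>
          norm (\<phi> s - \<phi> t - D * (s - t)) \<le> e * norm (s - t)"
        using \<open>e > 0\<close> unfolding has_field_derivative_def has_derivative_within_alt by meson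
      have "\<phi> v - \<phi> u \<le> (h t + e) * (v - u)"
        if "u \<in> {a..b}" "v \<in> {a..b}" "u \<in> ball t r" "v \<in> ball t r" "u \<le> t" "t \<le> v" for u v
      proof -
        have "norm (v - t) = v - t" "norm (u - t) = t - u" "norm (v - t) < r" "norm (u - t) < r"
          using that by (auto simp: dist_norm)
        then have "\<bar>\<phi> v - \<phi> t - D * (v - t)\<bar> \<le> e * (v - t)"
          "\<bar>\<phi> u - \<phi> t - D * (u - t)\<bar> \<le> e * (t - u)"
          using r[of u] r[of v] that(1,2) by auto
        \<comment> \<open>Because \<open>t\<close> lies between \<open>u\<close> and
          \<open>v\<close>, the two one-sided errors add up to exactly
          \<open>e * (v - u)\<close>.\<close>
        then have "\<phi> v - \<phi> t - D * (v - t) \<le> e * (v - t)" "- (\<phi> u - \<phi> t - D * (u - t)) \<le> e * (t - u)"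
          by linarith+
        then have "\<phi> v - \<phi> u \<le> (D + e) * (v - u)" by (simp add: algebra_simps)
        also have "\<dots> \<le> (h t + e) * (v - u)"
          using D that by (intro mult_right_mono) auto
        finally show ?thesis .
      qed
      with False \<open>r > 0\<close> show ?thesis by blast
    next
      case False
      with \<open>t \<notin> N\<close> show ?thesis by (auto intro: exI[of _ 1])
    qed
  qed
  then obtain r where r: "\<And>t. r t > 0" "\<And>t. t \<in> N \<Longrightarrow> ball t (r t) \<subseteq> U"
    "\<And>t u v. t \<in> {a..b} - N \<Longrightarrow> u \<in> {a..b} \<Longrightarrow> v \<in> {a..b} \<Longrightarrow> u \<in> ball t (r t) \<Longrightarrow>
      v \<in> ball t (r t) \<Longrightarrow> u \<le> t \<Longrightarrow> t \<le> v \<Longrightarrow> \<phi> v - \<phi> u \<le> (h t + e) * (v - u)"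
    by metis
  have "gauge (\<lambda>t. \<gamma>1 t \<inter> ball t (r t))"
    using \<gamma>1(1) r(1) by (intro gauge_Int) (auto simp: gauge_def)
  then obtain p where p: "p tagged_division_of (cbox a b)" "(\<lambda>t. \<gamma>1 t \<inter> ball t (r t)) fine p"
    using fine_division_exists by blast
  then have fine: "\<gamma>1 fine p" "(\<lambda>t. ball t (r t)) fine p" by (auto simp: fine_Int)
  have finp: "finite p" using p by blast
  define inc where "inc = (\<lambda>K. \<phi> (Sup K) - \<phi> (Inf K))"
  have intv: "\<exists>u v. K = {u..v} \<and> u \<le> t \<and> t \<le> v \<and> u \<in> {a..b} \<and> v \<in> {a..b} \<and>
      u \<in> ball t (r t) \<and> v \<in> ball t (r t) \<and> t \<in> {a..b}" if tK: "(t, K) \<in> p" for t K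
  proof -
    obtain u v where "K = {u..v}" using tagged_division_ofD(4)[OF p(1) tK] by (auto simp: box_real)
    moreover have "t \<in> K" "K \<subseteq> {a..b}" "K \<subseteq> ball t (r t)"
      using tagged_division_ofD(2,3)[OF p(1) tK] fineD[OF fine(2) tK] by (auto simp: box_real)
    ultimately show ?thesis
      by (intro exI[of _ u] exI[of _ v]) (auto simp: subset_iff)
  qed
  define pN where "pN = {(t, K) \<in> p. t \<in> N}"
  have pN: "pN \<subseteq> p" by (auto simp: pN_def)
  have out: "inc K \<le> measure lborel K * (h' t + e)" if "(t, K) \<in> p - pN" for t K
  proof -
    from that obtain u v where K: "K = {u..v}" "u \<le> t" "t \<le> v" "u \<in> {a..b}" "v \<in> {a..b}"
      "u \<in> ball t (r t)" "v \<in> ball t (r t)" "t \<in> {a..b}" using intv[of t K] by auto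
    have "t \<notin> N" using that by (auto simp: pN_def)
    with K r(3)[of t u v] show ?thesis
      by (simp add: inc_def h'_def mult.commute)
  qed
  have pN_td: "pN tagged_partial_division_of {a..b}"
    using tagged_partial_division_subset[OF _ pN] p(1)
    by (auto simp: tagged_division_of_def box_real)
  have "(\<Sum>(t,K)\<in>pN. norm (inc K)) < e"
  proof -
    have td: "pN tagged_division_of \<Union>(snd ` pN)"
      using tagged_partial_division_of_Union_self[OF pN_td] .
    have dv: "snd ` pN division_of \<Union>(snd ` pN)"
      by (rule division_of_tagged_division[OF td])
    have ne: "K \<noteq> {}" if "K \<in> snd ` pN" for K
      using division_ofD(3)[OF dv that] .
    \<comment> \<open>Passing from tagged pairs to their intervals needs a summand that vanishes on
      every degenerate box. The guard handles the empty box, whose \<open>Sup\<close> and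
      \<open>Inf\<close> carry no information.\<close>
    define inc' where "inc' = (\<lambda>K. if K = {} then 0 else norm (inc K))"
    have "inc' (cbox u v) = 0" if "box u v = {}" for u v
      using that by (auto simp: inc'_def inc_def box_real)
    then have "(\<Sum>(t,K)\<in>pN. inc' K) = (\<Sum>K\<in>snd ` pN. inc' K)"
      by (intro sum.over_tagged_division_lemma[OF td])
    also have "(\<Sum>(t,K)\<in>pN. inc' K) = (\<Sum>(t,K)\<in>pN. norm (inc K))"
      using ne by (intro sum.cong) (force simp: inc'_def)+
    also have "(\<Sum>K\<in>snd ` pN. inc' K) = (\<Sum>K\<in>snd ` pN. norm (inc K))"
      using ne by (intro sum.cong) (auto simp: inc'_def)
    also have "\<dots> < e"
      unfolding inc_def
    proof (rule d[OF dv])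
      show "\<Union>(snd ` pN) \<subseteq> {a..b}"
        using tagged_partial_division_ofD(3)[OF pN_td] by fastforce
      \<comment> \<open>Absolute continuity measures intervals by \<open>lborel\<close> and
        \<open>U\<close> is measured by \<open>lebesgue\<close>; on boxes the two agree.\<close>
      have "(\<Sum>K\<in>snd ` pN. measure lborel K) = (\<Sum>K\<in>snd ` pN. measure lebesgue K)"
        using division_ofD(4)[OF dv]
        by (intro sum.cong refl) (metis borel_closed closed_cbox measure_completion sets_lborel)
      also have "\<dots> = measure lebesgue (\<Union>(snd ` pN))"
        by (rule content_division[OF dv])
      also have "\<dots> \<le> measure lebesgue U"
      proof (rule measure_mono_fmeasurable[OF _ _ Um])
        show "\<Union>(snd ` pN) \<subseteq> U"
        proof clarsimp
          fix t K s assume "(t, K) \<in> pN" "s \<in> K"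
          then show "s \<in> U"
            using r(2)[of t] fineD[OF fine(2), of t K] by (auto simp: pN_def)
        qed
        show "\<Union>(snd ` pN) \<in> sets lebesgue"
          using lmeasurable_division[OF dv] by auto
      qed
      finally show "(\<Sum>K\<in>snd ` pN. measure lborel K) < d" using Ud by linarith
    qed
    finally show ?thesis .
  qed
  then have sN: "(\<Sum>(t,K)\<in>pN. inc K) < e"
    by (rule le_less_trans[rotated]) (auto intro!: sum_mono)
  have hN: "(\<Sum>(t,K)\<in>pN. measure lborel K * h' t) = 0"
    by (rule sum.neutral) (auto simp: pN_def h'_def)
  have "\<phi> b - \<phi> a = (\<Sum>(t,K)\<in>p. inc K)"
    unfolding inc_def by (rule additive_tagged_division_1[OF \<open>a \<le> b\<close> p(1)[unfolded box_real], symmetric])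
  also have "\<dots> = (\<Sum>(t,K)\<in>p - pN. inc K) + (\<Sum>(t,K)\<in>pN. inc K)"
    by (rule sum.subset_diff[OF pN finp])
  also have "\<dots> \<le> (\<Sum>(t,K)\<in>p - pN. measure lborel K * (h' t + e)) + e"
    using sN out by (intro add_mono sum_mono) auto
  also have "(\<Sum>(t,K)\<in>p - pN. measure lborel K * (h' t + e)) =
      (\<Sum>(t,K)\<in>p - pN. measure lborel K * h' t) + e * (\<Sum>(t,K)\<in>p - pN. measure lborel K)"
    by (simp add: case_prod_beta sum_distrib_left sum.distrib[symmetric] algebra_simps)
  also have "(\<Sum>(t,K)\<in>p - pN. measure lborel K * h' t) = (\<Sum>(t,K)\<in>p. measure lborel K * h' t)"
    using sum.subset_diff[OF pN finp, of "\<lambda>(t,K). measure lborel K * h' t"] hN by simp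
  also have "\<dots> \<le> I + e"
    using \<gamma>1(2)[OF p(1) fine(1)] by simp
  also have "(\<Sum>(t,K)\<in>p - pN. measure lborel K) \<le> (\<Sum>(t,K)\<in>p. measure lborel K)"
    using finp by (intro sum_mono2) auto
  also have "\<dots> = b - a"
    using additive_content_tagged_division[OF p(1)] \<open>a \<le> b\<close> by simp
  finally have "\<phi> b - \<phi> a \<le> I + e * (b - a + 2)"
    using \<open>e > 0\<close> by (simp add: algebra_simps)
  then show "\<phi> b - \<phi> a \<le> I + e0"
    using \<open>a \<le> b\<close> by (simp add: e_def)
qed

section \<open>Feasible points, energy inequality and bound on the fit\<close>

text \<open>A subgradient at the limit point is an affine minorant that is at most zero along the
  sequence, and it attains the value of the function at the limit. This replaces continuity, which
  may fail on the boundary of \<open>X\<close>.\<close>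

lemma closed_feasible_points:
  fixes X :: "(real ^ 'n) set" and f :: "real \<Rightarrow> real ^ 'n \<Rightarrow> real ^ 'm"
  assumes "closed X"
    and sub: "\<And>t z i. z \<in> X \<Longrightarrow> \<exists>v. is_subgradient X (\<lambda>y. f t y $ i) z v"
  shows "closed (feasible_points X f T)"
  unfolding closed_sequential_limits
proof (intro allI impI, elim conjE)
  fix s z assume s: "\<forall>n. s n \<in> feasible_points X f T" and lim: "s \<longlonglongrightarrow> z"
  then have sX: "s n \<in> X" for n by (simp add: feasible_points_def)
  then have "z \<in> X" using \<open>closed X\<close> lim closed_sequentially by blast
  have "f t z $ i \<le> 0" if "t \<in> {0..T}" for t i
  proof -
    obtain v where v: "is_subgradient X (\<lambda>y. f t y $ i) z v" using sub[OF \<open>z \<in> X\<close>] by blast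
    have "(\<lambda>n. f t z $ i + v \<bullet> (s n - z)) \<longlonglongrightarrow> f t z $ i + v \<bullet> (z - z)"
      by (intro tendsto_intros lim)
    moreover have "f t z $ i + v \<bullet> (s n - z) \<le> 0" for n
    proof -
      have "f t (s n) $ i \<le> 0"
        using s that by (auto simp: feasible_points_def less_eq_vec_def)
      then show ?thesis using v sX[of n] unfolding is_subgradient_def by fastforce
    qed
    ultimately show ?thesis using LIMSEQ_le_const2 by fastforce
  qed
  with \<open>z \<in> X\<close> show "z \<in> feasible_points X f T"
    by (auto simp: feasible_points_def less_eq_vec_def)
qed

lemma convex_atLeast_vec: "convex {a :: real ^ 'm..}"
proof -
  have "{a..} = (\<Inter>i. {v. axis i 1 \<bullet> v \<ge> a $ i})"
    by (auto simp: less_eq_vec_def inner_axis')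
  then show ?thesis
    by (auto intro!: convex_INT convex_halfspace_ge)
qed

text \<open>The primal term is tested at \<open>z\<close> and the dual one at the basis vector
  \<open>axis i 1\<close> of the orthant. They contribute
  \<open>- \<epsilon> * (l \<bullet> F x)\<close> and
  \<open>\<epsilon> * (l \<bullet> F x) - \<epsilon> * F x $ i\<close>, so the coupling
  cancels.\<close>

lemma saddle_energy_derivative_le:
  fixes X :: "(real ^ 'n) set" and A :: "real ^ 'm ^ 'n" and F :: "real ^ 'n \<Rightarrow> real ^ 'm"
  assumes X: "closed X" "convex X"
    and sub: "\<And>j. is_subgradient X (\<lambda>y. F y $ j) x (column j A)"
    and mem: "x \<in> X" "l \<in> {0..}" "z \<in> X" and Fz: "F z \<le> 0" and "\<epsilon> > 0"
  shows "(x - z) \<bullet> proj_dir X x (- (\<epsilon> *\<^sub>R (A *v l))) + (l - axis i 1) \<bullet> proj_dir {0..} l (\<epsilon> *\<^sub>R F x)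
    \<le> - \<epsilon> * F x $ i"
proof -
  have "(x - z) \<bullet> proj_dir X x (- (\<epsilon> *\<^sub>R (A *v l))) \<le> (x - z) \<bullet> (- (\<epsilon> *\<^sub>R (A *v l)))"
    by (rule inner_proj_dir_le) (use X mem in auto)
  also have "\<dots> = \<epsilon> * (\<Sum>j\<in>UNIV. l $ j * (column j A \<bullet> (z - x)))"
    by (simp add: matrix_mult_sum inner_sum_right scalar_mult_eq_scaleR inner_diff inner_commute
        sum_subtractf sum_distrib_left algebra_simps)
  \<comment> \<open>Each subgradient inequality bounds the inner product by
    \<open>F z $ j - F x $ j\<close>, and \<open>F z $ j\<close> is nonpositive; nonnegative
    multipliers preserve the inequalities.\<close>
  also have "\<dots> \<le> \<epsilon> * (\<Sum>j\<in>UNIV. l $ j * (- F x $ j))"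
  proof (intro mult_left_mono sum_mono)
    fix j
    have "F z $ j \<le> 0" using Fz by (simp add: less_eq_vec_def)
    then show "column j A \<bullet> (z - x) \<le> - F x $ j"
      using sub[of j] mem unfolding is_subgradient_def by fastforce
    show "0 \<le> l $ j" using mem by (simp add: less_eq_vec_def)
  qed (use \<open>\<epsilon> > 0\<close> in auto)
  also have "\<dots> = - \<epsilon> * (l \<bullet> F x)"
    by (simp add: inner_vec_def sum_negf)
  finally have 1: "(x - z) \<bullet> proj_dir X x (- (\<epsilon> *\<^sub>R (A *v l))) \<le> - \<epsilon> * (l \<bullet> F x)" .
  have "(l - axis i 1) \<bullet> proj_dir {0..} l (\<epsilon> *\<^sub>R F x) \<le> (l - axis i 1) \<bullet> (\<epsilon> *\<^sub>R F x)"
    by (rule inner_proj_dir_le)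
      (use mem convex_atLeast_vec in \<open>auto simp: less_eq_vec_def axis_def\<close>)
  also have "\<dots> = \<epsilon> * (l \<bullet> F x) - \<epsilon> * F x $ i"
    by (simp add: inner_diff_left inner_axis' algebra_simps)
  finally show ?thesis using 1 by simp
qed

text \<open>Integration commutes with the bounded linear coordinate map. Integrability excludes the
  default value \<open>0\<close> of the vector integral.\<close>

lemma fit_component:
  fixes f :: "real \<Rightarrow> 'a \<Rightarrow> real ^ 'm"
  assumes "(\<lambda>t. f t (x t)) absolutely_integrable_on {0..T}"
  shows "fit f x T $ i = (LINT t:{0..T}|lebesgue. f t (x t) $ i)"
  using assms integral_bounded_linear[OF bounded_linear_vec_nth[of i], symmetric]
  unfolding fit_def set_lebesgue_integral_def set_integrable_def by fastforce

text \<open>The energy inequality is integrated over \<open>{0..T}\<close>, so feasibility of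
  \<open>z\<close> on that interval suffices; the final energy is nonnegative and can be
  discarded.\<close>

lemma fit_le_energy:
  fixes X :: "(real ^ 'n) set" and f :: "real \<Rightarrow> real ^ 'n \<Rightarrow> real ^ 'm"
  assumes X: "closed X" "convex X"
    and sub: "\<And>t z i. z \<in> X \<Longrightarrow> is_subgradient X (\<lambda>y. f t y $ i) z (column i (fx t z))"
    and "\<epsilon> > 0" and sol: "saddle_point_solution X f fx \<epsilon> x l"
    and int: "(\<lambda>t. f t (x t)) absolutely_integrable_on {0..T}"
    and "T > 0" and z: "z \<in> feasible_points X f T"
  shows "fit f x T $ i \<le> 1 / \<epsilon> * energy z (axis i 1) (x 0) (l 0)"
proof -
  define V where "V = (\<lambda>t. energy z (axis i 1) (x t) (l t))"
  have mem: "x t \<in> X" "l t \<in> {0..}" if "t \<ge> 0" for t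
    using sol that by (auto simp: saddle_point_solution_def)
  have "AE t in lebesgue. t \<ge> 0 \<longrightarrow>
        (x has_vector_derivative proj_dir X (x t) (- (\<epsilon> *\<^sub>R (fx t (x t) *v l t)))) (at t within {0..}) \<and>
        (l has_vector_derivative proj_dir {0..} (l t) (\<epsilon> *\<^sub>R f t (x t))) (at t within {0..})"
    using sol by (simp add: saddle_point_solution_def)
  then obtain N where N: "N \<in> null_sets lebesgue" and der: "\<And>t. t \<notin> N \<Longrightarrow> t \<ge> 0 \<Longrightarrow>
        (x has_vector_derivative proj_dir X (x t) (- (\<epsilon> *\<^sub>R (fx t (x t) *v l t)))) (at t within {0..}) \<and>
        (l has_vector_derivative proj_dir {0..} (l t) (\<epsilon> *\<^sub>R f t (x t))) (at t within {0..})"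
    unfolding eventually_ae_filter by fastforce
  have inti: "(\<lambda>t. f t (x t) $ i) absolutely_integrable_on {0..T}"
    using absolutely_integrable_linear[OF int bounded_linear_vec_nth[of i]]
    by (simp add: o_def)
  then have hi: "((\<lambda>t. f t (x t) $ i) has_integral fit f x T $ i) {0..T}"
    unfolding fit_component[where f = f and x = x, OF int] by (rule has_integral_set_lebesgue)
  have "V T - V 0 \<le> - \<epsilon> * fit f x T $ i"
  proof (rule abs_continuous_on_increment_le_integral
      [where a = 0 and b = T and \<phi> = V])
    show "abs_continuous_on {0..T} V"
      unfolding V_def using sol \<open>T > 0\<close>
      by (intro abs_continuous_on_energy) (auto simp: saddle_point_solution_def)
    show "negligible N" using N by (simp add: negligible_iff_null_sets)
    show "((\<lambda>t. - \<epsilon> * f t (x t) $ i) has_integral - \<epsilon> * fit f x T $ i) {0..T}"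
      by (rule has_integral_mult_right[OF hi])
    fix t assume t: "t \<in> {0..T} - N"
    let ?D = "(x t - z) \<bullet> proj_dir X (x t) (- (\<epsilon> *\<^sub>R (fx t (x t) *v l t))) +
      (l t - axis i 1) \<bullet> proj_dir {0..} (l t) (\<epsilon> *\<^sub>R f t (x t))"
    have "(V has_real_derivative ?D) (at t within {0..})"
      unfolding V_def using der[of t] t by (intro energy_has_real_derivative) auto
    then have "(V has_real_derivative ?D) (at t within {0..T})"
      by (rule DERIV_subset) auto
    moreover have "?D \<le> - \<epsilon> * f t (x t) $ i"
      by (rule saddle_energy_derivative_le[OF X])
        (use sub mem t z \<open>\<epsilon> > 0\<close> in \<open>auto simp: feasible_points_def\<close>)
    ultimately show "\<exists>D. (V has_real_derivative D) (at t within {0..T}) \<and> D \<le> - \<epsilon> * f t (x t) $ i"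
      by blast
  qed (use \<open>T > 0\<close> in auto)
  moreover have "V T \<ge> 0" by (simp add: V_def energy_def)
  ultimately have "\<epsilon> * fit f x T $ i \<le> V 0" by simp
  then show ?thesis using \<open>\<epsilon> > 0\<close> by (simp add: V_def field_simps)
qed

theorem theorem2:
  fixes X :: "(real ^ 'n) set"
    and f :: "real \<Rightarrow> real ^ 'n \<Rightarrow> real ^ 'm"
    and fx :: "real \<Rightarrow> real ^ 'n \<Rightarrow> real ^ 'm ^ 'n"
    and \<epsilon> :: real
    and x :: "real \<Rightarrow> real ^ 'n"
    and l :: "real \<Rightarrow> real ^ 'm"
  assumes "closed X" and "convex X"
    and "\<And>T z. T > 0 \<Longrightarrow> z \<in> X \<Longrightarrow> (\<lambda>t. f t z) absolutely_integrable_on {0..T}"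
    and "\<And>t i. convex_on X (\<lambda>z. f t z $ i)"
    and "\<And>t z i. z \<in> X \<Longrightarrow> is_subgradient X (\<lambda>y. f t y $ i) z (column i (fx t z))"
    and "viable X f"
    and "\<epsilon> > 0"
    and "saddle_point_solution X f fx \<epsilon> x l"
    and "\<And>T. T > 0 \<Longrightarrow> (\<lambda>t. f t (x t)) absolutely_integrable_on {0..T}"
  shows "strongly_feasible f x \<and>
    (\<forall>T>0. \<forall>i.
       fit f x T $ i = (LINT t:{0..T}|lebesgue. f t (x t) $ i) \<and>
       (\<exists>xdag. is_arg_min (\<lambda>z. 1 / \<epsilon> * energy z (axis i 1) (x 0) (l 0))
                  (\<lambda>z. z \<in> feasible_points X f T) xdag \<and>
               fit f x T $ i \<le> 1 / \<epsilon> * energy xdag (axis i 1) (x 0) (l 0)))"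
proof -
  obtain z0 where "z0 \<in> X" "\<forall>t\<ge>0. f t z0 \<le> 0"
    using assms(6) by (auto simp: viable_def)
  then have z0: "z0 \<in> feasible_points X f T" for T
    by (simp add: feasible_points_def)
  have bound: "fit f x T $ i \<le> 1 / \<epsilon> * energy z (axis i 1) (x 0) (l 0)"
    if "T > 0" "z \<in> feasible_points X f T" for T z i
    by (rule fit_le_energy[OF assms(1,2,5,7,8) assms(9)]) (use that in auto)
  \<comment> \<open>The viable point \<open>z0\<close> is feasible for every horizon, so the
    constant it yields does not depend on \<open>T\<close>.\<close>
  have "\<forall>T>0. fit f x T \<le> (\<chi> i. 1 / \<epsilon> * energy z0 (axis i 1) (x 0) (l 0))"
    using bound z0 by (simp add: less_eq_vec_def)
  then have "strongly_feasible f x" unfolding strongly_feasible_def by blast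
  moreover have "\<exists>xdag. is_arg_min (\<lambda>z. 1 / \<epsilon> * energy z (axis i 1) (x 0) (l 0))
                  (\<lambda>z. z \<in> feasible_points X f T) xdag \<and>
               fit f x T $ i \<le> 1 / \<epsilon> * energy xdag (axis i 1) (x 0) (l 0)" if "T > 0" for T i
  proof -
    have "closed (feasible_points X f T)"
      using closed_feasible_points assms(1,5) by blast
    \<comment> \<open>The multiplier part of the energy does not involve \<open>z\<close>, so a
      feasible point nearest to \<open>x 0\<close> is a minimiser for every
      \<open>i\<close>.\<close>
    then obtain w where w: "w \<in> feasible_points X f T"
      "\<And>z. z \<in> feasible_points X f T \<Longrightarrow> dist (x 0) w \<le> dist (x 0) z"
      using distance_attains_inf z0 by (metis empty_iff)
    have "1 / \<epsilon> * energy w (axis i 1) (x 0) (l 0) \<le> 1 / \<epsilon> * energy z (axis i 1) (x 0) (l 0)"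
      if "z \<in> feasible_points X f T" for z
      using w(2)[OF that] \<open>\<epsilon> > 0\<close> unfolding energy_def
      by (intro mult_left_mono add_right_mono power_mono) (auto simp: dist_norm)
    with w(1) have "is_arg_min (\<lambda>z. 1 / \<epsilon> * energy z (axis i 1) (x 0) (l 0))
        (\<lambda>z. z \<in> feasible_points X f T) w"
      unfolding is_arg_min_linorder by blast
    with bound[OF that w(1)] show ?thesis by blast
  qed
  ultimately show ?thesis using fit_component assms(9) by blast
qed

end
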